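(* Let $a,b\in\mathbb{Z}\setminus\{0\}$. The Diophantine equation $a(x^2-y^4)=b(z^6-w^{12})$ has infinitely many non-trivial coprime solutions $x,y,z,w$ in the polynomial ring $\mathbb{Z}[t]$.
   Context: A solution is called trivial if both sides vanish separately for trivial reasons (e.g. $x^2=y^4$ and $z^6=w^{12}$); such solutions are discarded. "Coprime" means $\gcd(x,y,z,w)=1$ in $\mathbb{Z}[t]$. *)

theory Defs
  imports "HOL-Computational_Algebra.Computational_Algebra"
begin

definition trivial_solution ::
    "int poly \<Rightarrow> int poly \<Rightarrow> int poly \<Rightarrow> int poly \<Rightarrow> bool" where
  "trivial_solution x y z w \<longleftrightarrow> x ^ 2 = y ^ 4 \<and> z ^ 6 = w ^ 12"

end

theory Submission
  imports Defs
begin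

text \<open>
  In the coordinates \<open>X = x / w^6\<close>, \<open>Y = y / w^3\<close>, \<open>Z = z / w^2\<close> the equation describes a
  surface, fibred into the curves \<open>X - Y^2 = s^2 (Z^3 - 1)\<close>, \<open>X + Y^2 = b / (a s^2) (Z^3 + 1)\<close>,
  that is \<open>2 Y^2 = (b / (a s^2) - s^2) Z^3 + b / (a s^2) + s^2\<close>. This elliptic curve over
  \<open>\<rat>(s)\<close> has the point \<open>(Z, Y) = (-1, s)\<close>, which lies on \<open>X + Y^2 = 0\<close>; the tangent there
  meets the curve again at a point with \<open>Z = (9 b + 7 a s^4) / (8 a s^4)\<close>. Choosing
  \<open>s = 54 a b^2 u^3\<close> turns the denominator of \<open>Y\<close> into a perfect cube, so that the denominators
  can be cleared with \<open>y \<equiv> 1\<close> modulo every prime factor of \<open>w\<close>, which gives coprimality.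
  Here \<open>u\<close> is an arbitrary nonzero polynomial.
\<close>

definition sol_w :: "'a::comm_ring_1 \<Rightarrow> 'a \<Rightarrow> 'a \<Rightarrow> 'a" where
  "sol_w a b u = 2^4 * 3^6 * a^3 * b^4 * u^7"

definition sol_z :: "'a::comm_ring_1 \<Rightarrow> 'a \<Rightarrow> 'a \<Rightarrow> 'a" where
  "sol_z a b u = 18 * a * b * u^2 * (1 + 112 * 3^10 * (a^5 * b^7 * u^12))"

definition sol_y :: "'a::comm_ring_1 \<Rightarrow> 'a \<Rightarrow> 'a \<Rightarrow> 'a" where
  "sol_y a b u = 1 + 288 * 3^9 * (a^5 * b^7 * u^12) - 3328 * 3^21 * (a^5 * b^7 * u^12)^2"

text \<open>The first fibre equation cleared of denominators, with
  \<open>s = 54 * a * b^2 * u^3\<close>; only the second one is left to check.\<close>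

definition sol_x :: "'a::comm_ring_1 \<Rightarrow> 'a \<Rightarrow> 'a \<Rightarrow> 'a" where
  "sol_x a b u =
     (sol_y a b u)^2 + (54 * a * b^2 * u^3)^2 * ((sol_z a b u)^3 - (sol_w a b u)^6)"

lemma sol_on_fibre:
  fixes a b u :: "'a::idom"
  shows "a * (54 * a * b^2 * u^3)^2 * (sol_x a b u + (sol_y a b u)^2) =
         b * ((sol_z a b u)^3 + (sol_w a b u)^6)"
proof -
  \<comment> \<open>After common factors are pulled out, \<open>a\<close>, \<open>b\<close>,
    \<open>u\<close> enter only through \<open>e\<close>, so the claim reduces to the one-variable
    identity \<open>key\<close>.\<close>
  define e where "e = a^5 * b^7 * u^12"
  define y where "y = 1 + 288 * 3^9 * e - 3328 * 3^21 * e^2"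
  define v where "v = 1 + 112 * 3^10 * e"
  have z3: "(sol_z a b u)^3 = 18^3 * a^3 * b^3 * u^6 * v^3"
    by (simp add: sol_z_def v_def e_def power_mult_distrib flip: power_mult)
  have w6: "(sol_w a b u)^6 = 18^3 * a^3 * b^3 * u^6 * (2^7 * 3^10 * e)^3"
    by (simp add: sol_w_def e_def power_mult_distrib flip: power_mult power_add) algebra
  have key: "2 * y^2 + 54^2 * 18^3 * e * (v^3 - (2^7 * 3^10 * e)^3) =
             2 * (v^3 + (2^7 * 3^10 * e)^3)"
    unfolding y_def v_def by algebra
  have x: "sol_x a b u + (sol_y a b u)^2 =
             2 * y^2 + 54^2 * 18^3 * e * (v^3 - (2^7 * 3^10 * e)^3)"
    unfolding sol_x_def z3 w6 by (simp add: sol_y_def y_def e_def) algebra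
  show ?thesis
    unfolding x key z3 w6 by (simp add: power_mult_distrib) algebra
qed

text \<open>Both sides split as differences of squares; multiplying the two fibre equations matches
  the factors.\<close>

lemma sol_solves:
  fixes a b u :: "'a::idom"
  shows "a * ((sol_x a b u)^2 - (sol_y a b u)^4) = b * ((sol_z a b u)^6 - (sol_w a b u)^12)"
proof -
  define x y z w where "x = sol_x a b u" and "y = sol_y a b u"
    and "z = sol_z a b u" and "w = sol_w a b u"
  define s where "s = 54 * a * b^2 * u^3"
  have "a * s^2 * (x + y^2) = b * (z^3 + w^6)"
    unfolding s_def x_def y_def z_def w_def by (rule sol_on_fibre)
  moreover have "x = y^2 + s^2 * (z^3 - w^6)"
    unfolding s_def x_def y_def z_def w_def by (rule sol_x_def)
  ultimately have "a * (x^2 - y^4) = b * (z^6 - w^12)"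
    by algebra
  then show ?thesis
    unfolding x_def y_def z_def w_def .
qed

lemma coprime_sol_y_sol_w:
  fixes a b u :: "'a::{idom,ring_gcd}"
  shows "coprime (sol_y a b u) (sol_w a b u)"
proof -
  \<comment> \<open>\<open>m\<close> collects the possible prime factors of \<open>w\<close>: y is 1
    modulo \<open>m\<close>, and \<open>w\<close> divides \<open>m ^ 7\<close>.\<close>
  define m where "m = 6 * a * b * u"
  have "sol_y a b u = 1 + m * (a^4 * b^6 * u^11 * (48 * 3^9 - 1664 * 3^20 * (a^5 * b^7 * u^12)))"
    unfolding sol_y_def m_def by algebra
  then have "coprime (sol_y a b u) m"
    by (metis coprime_1_left coprime_iff_gcd_eq_1 gcd.commute gcd_add_mult mult.commute add.commute)
  then have "coprime (sol_y a b u) (m ^ 7)"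
    by simp
  moreover have "m ^ 7 = sol_w a b u * (2^3 * 3 * a^4 * b^3)"
    unfolding m_def sol_w_def by algebra
  ultimately show ?thesis
    by simp
qed

text \<open>Parity: z and w^2 share the factor \<open>c\<close>, with odd and even cofactors
  respectively.\<close>

lemma sol_nontrivial:
  fixes a b u :: "'a::{idom,ring_char_0}"
  assumes "a \<noteq> 0" "b \<noteq> 0" "u \<noteq> 0" and odd: "\<not> (2::'a) dvd 1"
  shows "(sol_z a b u)^6 \<noteq> (sol_w a b u)^12"
proof
  assume eq: "(sol_z a b u)^6 = (sol_w a b u)^12"
  define e where "e = a^5 * b^7 * u^12"
  define c where "c = 18 * a * b * u^2"
  have z: "sol_z a b u = c * (1 + 2 * (56 * 3^10 * e))"
    unfolding sol_z_def c_def e_def by algebra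
  have w: "(sol_w a b u)^2 = c * (2 * (2^6 * 3^10 * e))"
    unfolding sol_w_def c_def e_def by algebra
  have "(sol_w a b u)^12 = ((sol_w a b u)^2)^6"
    by (simp flip: power_mult)
  with eq have "c^6 * (1 + 2 * (56 * 3^10 * e))^6 = c^6 * (2 * (2^6 * 3^10 * e))^6"
    unfolding z w by (simp only: power_mult_distrib)
  moreover have "c \<noteq> 0"
    using assms by (simp add: c_def)
  ultimately have "(1 + 2 * (56 * 3^10 * e))^6 = (2 * (2^6 * 3^10 * e))^6"
    by simp
  moreover define f where "f = 56 * 3^10 * e"
  moreover define g where "g = 2^6 * 3^10 * e"
  ultimately have "(1 + 2 * f)^6 = (2 * g)^6"
    by simp
  then have "1 = 2 * (2^5 * g^6 - (6*f + 30*f^2 + 80*f^3 + 120*f^4 + 96*f^5 + 32*f^6))"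
    by algebra
  then show False
    using odd dvdI by blast
qed

theorem theorem4p1:
  fixes a b :: int
  assumes "a \<noteq> 0" and "b \<noteq> 0"
  shows "infinite {(x, y, z, w).
           [:a:] * (x ^ 2 - y ^ 4) = [:b:] * (z ^ 6 - w ^ 12) \<and>
           \<not> trivial_solution x y z w \<and>
           Gcd {x, y, z, w} = 1}"
    (is "infinite ?S")
proof -
  define A B :: "int poly" where "A = [:a:]" and "B = [:b:]"
  \<comment> \<open>Powers of t, so that the degree of \<open>u n ^ 7\<close>, a factor of w,
    recovers \<open>n\<close>.\<close>
  define u :: "nat \<Rightarrow> int poly" where "u n = monom 1 n" for n
  define f where "f n = (sol_x A B (u n), sol_y A B (u n), sol_z A B (u n), sol_w A B (u n))" for n
  have nz: "A \<noteq> 0" "B \<noteq> 0" "u n \<noteq> 0" for n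
    using assms by (simp_all add: A_def B_def u_def)
  have odd: "\<not> (2 :: int poly) dvd 1"
  proof
    assume "(2 :: int poly) dvd 1"
    then obtain k :: "int poly" where "1 = 2 * k"
      by (rule dvdE)
    \<comment> \<open>Evaluation at 0 would make the integer 1 even.\<close>
    then have "poly 1 0 = poly (2 * k) 0"
      by simp
    then show False
      by simp presburger
  qed
  have "f n \<in> ?S" for n
  proof -
    have "Gcd {sol_x A B (u n), sol_y A B (u n), sol_z A B (u n), sol_w A B (u n)} dvd 1"
      using coprime_sol_y_sol_w[of A B "u n"]
      by (rule coprime_common_divisor; intro Gcd_dvd; simp)
    then have "Gcd {sol_x A B (u n), sol_y A B (u n), sol_z A B (u n), sol_w A B (u n)} = 1"
      by (metis is_unit_normalize normalize_Gcd)
    then show ?thesis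
      using sol_solves[of A B "u n"] sol_nontrivial[OF nz odd]
      by (simp add: f_def trivial_solution_def A_def B_def)
  qed
  moreover have "inj f"
  proof (rule injI)
    fix m n
    assume "f m = f n"
    then have "sol_w A B (u m) = sol_w A B (u n)"
      by (simp add: f_def)
    then have "u m ^ 7 = u n ^ 7"
      using nz by (simp add: sol_w_def)
    then have "degree (u m ^ 7) = degree (u n ^ 7)"
      by simp
    then show "m = n"
      by (simp add: u_def monom_power degree_monom_eq)
  qed
  ultimately show ?thesis
    by (meson finite_subset image_subsetI infinite_UNIV_nat finite_imageD)
qed

end
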